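(* Let $G$ be a graph, let $v_c\in V(G)$, and let $\widetilde{G}$ be a graph obtained from $G$ by the $L$-cospectral construction with fixed vertex $v_c$ (defined in the context), with subgraphs $G^1, G^2$. Then the vertices $v_c^1$ and $v_c^2$ are $L$-cospectral in $\widetilde{G}$.
   Context: All graphs (including the constructed ones) are finite, nonempty, undirected, connected, without loops (and without multiple edges). For a graph $G$ and $v_c\in V(G)$, $\mathrm{Aut}(G,v_c)$ is the group of graph automorphisms of $G$ that fix $v_c$, and $[v_j]_{v_c}\subseteq V(G)$ is the orbit of the vertex $v_j$ under the action of $\mathrm{Aut}(G,v_c)$ on $V(G)$. $L$-cospectral construction. Take two vertex-disjoint copies $G^1,G^2$ of $G$; the copies of $v_j\in V(G)$ in $G^1$ and $G^2$ are denoted $v_j^1$ and $v_j^2$. Keep all edges of $G^1$ and $G^2$ and add any number of edges between $V(G^1)$ and $V(G^2)$ subject to the condition that if an edge joins $v_j^1\in V(G^1)$ and $v_m^2\in V(G^2)$, then $v_m\in[v_j]_{v_c}$. The resulting graph is $\widetilde G$. The Laplacian matrix of a graph is $L=D-A$, where $A$ is the adjacency matrix and $D$ is the diagonal matrix of vertex degrees. For a graph with $n$ vertices, the vertex $v$ is associated with a standard basis vector $\boldsymbol{v}\in\mathbb{R}^n$. For a linear map (matrix) $M$ on $\mathbb{R}^n$ and $\boldsymbol{x}\in\mathbb{R}^n$, $\langle\boldsymbol{x}\rangle_M=\mathrm{span}\{\boldsymbol{x},M\boldsymbol{x},M^2\boldsymbol{x},\dots\}$. Two distinct vertices $v_i,v_j$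 of a graph with Laplacian $L$ are $L$-cospectral if the subspaces $\langle\boldsymbol{v}_i+\boldsymbol{v}_j\rangle_L$ and $\langle\boldsymbol{v}_i-\boldsymbol{v}_j\rangle_L$ are orthogonal. *)

theory Defs
  imports "HOL-Analysis.Analysis"
begin

text \<open>
  A graph is given by its adjacency relation on a type of class \<open>finite\<close>; the vertex set is the
  whole type, hence finite and nonempty. Following the paper's standing convention, graphs are
  simple and connected.
\<close>

definition connected_graph :: "('v::finite \<Rightarrow> 'v \<Rightarrow> bool) \<Rightarrow> bool" where
  "connected_graph E \<longleftrightarrow> symp E \<and> irreflp E \<and> (\<forall>u v. E\<^sup>*\<^sup>* u v)"

definition Aut_fixing :: "('v \<Rightarrow> 'v \<Rightarrow> bool) \<Rightarrow> 'v \<Rightarrow> ('v \<Rightarrow> 'v) set" where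
  "Aut_fixing E c = {f. bij f \<and> (\<forall>u v. E (f u) (f v) \<longleftrightarrow> E u v) \<and> f c = c}"

definition vertex_orbit :: "('v \<Rightarrow> 'v \<Rightarrow> bool) \<Rightarrow> 'v \<Rightarrow> 'v \<Rightarrow> 'v set" where
  "vertex_orbit E c v = {f v |f. f \<in> Aut_fixing E c}"

text \<open>
  The two disjoint copies of \<open>G\<close> are the summands of \<open>'v + 'v\<close>: \<open>Inl v\<close> is the copy of \<open>v\<close> in
  the first copy of \<open>G\<close> and \<open>Inr v\<close> its copy in the second. The predicate constrains only edges
  written from the first copy to the second; the converse direction is covered by the symmetry
  of \<open>E'\<close>, which is part of \<^const>\<open>connected_graph\<close>.
\<close>

definition L_cospectral_construction ::
    "('v \<Rightarrow> 'v \<Rightarrow> bool) \<Rightarrow> 'v \<Rightarrow> ('v + 'v \<Rightarrow> 'v + 'v \<Rightarrow> bool) \<Rightarrow> bool" where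
  "L_cospectral_construction E c E' \<longleftrightarrow>
     (\<forall>u v. E' (Inl u) (Inl v) \<longleftrightarrow> E u v) \<and>
     (\<forall>u v. E' (Inr u) (Inr v) \<longleftrightarrow> E u v) \<and>
     (\<forall>u v. E' (Inl u) (Inr v) \<longrightarrow> v \<in> vertex_orbit E c u)"

definition adjacency_matrix :: "('v::finite \<Rightarrow> 'v \<Rightarrow> bool) \<Rightarrow> real^'v^'v" where
  "adjacency_matrix E = (\<chi> u v. if E u v then 1 else 0)"

definition degree_matrix :: "('v::finite \<Rightarrow> 'v \<Rightarrow> bool) \<Rightarrow> real^'v^'v" where
  "degree_matrix E = (\<chi> u v. if u = v then real (card {w. E u w}) else 0)"

definition laplacian_matrix :: "('v::finite \<Rightarrow> 'v \<Rightarrow> bool) \<Rightarrow> real^'v^'v" where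
  "laplacian_matrix E = degree_matrix E - adjacency_matrix E"

text \<open>
  The power \<open>M\<^sup>k x\<close> is the \<open>k\<close>-fold iterate of \<open>(*v) M\<close>: the multiplication \<open>*\<close> on
  \<open>real^'v^'v\<close>, and so \<open>M ^ k\<close>, would be componentwise rather than the matrix product.
\<close>

definition cyclic_subspace :: "real^'v^'v \<Rightarrow> real^'v \<Rightarrow> (real^'v::finite) set" where
  "cyclic_subspace M x = span (range (\<lambda>k. (((*v) M) ^^ k) x))"

definition orthogonal_subspaces :: "'a::real_inner set \<Rightarrow> 'a set \<Rightarrow> bool" where
  "orthogonal_subspaces S T \<longleftrightarrow> (\<forall>x\<in>S. \<forall>y\<in>T. orthogonal x y)"

definition L_cospectral :: "('v::finite \<Rightarrow> 'v \<Rightarrow> bool) \<Rightarrow> 'v \<Rightarrow> 'v \<Rightarrow> bool" where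
  "L_cospectral E u v \<longleftrightarrow> u \<noteq> v \<and>
     orthogonal_subspaces
       (cyclic_subspace (laplacian_matrix E) (axis u 1 + axis v 1))
       (cyclic_subspace (laplacian_matrix E) (axis u 1 - axis v 1))"

end

theory Submission
  imports Defs
begin

text \<open>
  Why the two copies of \<open>c\<close> are cospectral: in the doubled graph consider the vectors that have the
  same restriction to both copies of \<open>G\<close> and whose restriction is constant on the orbits of
  \<open>Aut(G,c)\<close>. Every edge between the two copies joins two vertices on which such a vector takes
  the same value, so it contributes nothing to the Laplacian \<open>(L x)\<^sub>u = \<Sum>\<^bsub>w \<sim> u\<^esub> (x\<^sub>u - x\<^sub>w)\<close>. On these
  vectors the Laplacian of the doubled graph therefore acts as two copies of the Laplacian of \<open>G\<close>,
  which commutes with the automorphisms of \<open>G\<close>; hence they form an \<open>L\<close>-invariant subspace \<open>S\<close>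
  (\<open>laplacian_mirrored_invariant\<close>).

  The vector \<open>c\<^sup>1 + c\<^sup>2\<close> lies in \<open>S\<close> because the automorphisms fix \<open>c\<close>, and \<open>c\<^sup>1 - c\<^sup>2\<close> is orthogonal
  to \<open>S\<close> because the members of \<open>S\<close> agree on the two copies. As \<open>L\<close> is symmetric, the orthogonal
  complement of \<open>S\<close> is \<open>L\<close>-invariant as well, so \<open>S\<close> and its complement separate the two cyclic
  subspaces (\<open>orthogonal_cyclic_subspaces\<close>).
\<close>

lemma cyclic_subspace_least:
  fixes M :: "real^'n^'n"
  assumes "subspace S" and "\<And>z. z \<in> S \<Longrightarrow> M *v z \<in> S" and "x \<in> S"
  shows "cyclic_subspace M x \<subseteq> S"
proof -
  have "(((*v) M) ^^ k) x \<in> S" for k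
    by (induction k) (use assms in auto)
  then show ?thesis
    unfolding cyclic_subspace_def by (intro span_minimal) (use assms(1) in auto)
qed

text \<open>
  A symmetric matrix that maps \<open>S\<close> into itself also maps the orthogonal complement of \<open>S\<close> into
  itself, because \<open>M z \<bullet> s = z \<bullet> M s\<close>. Each cyclic subspace then stays on its side.
\<close>

lemma orthogonal_cyclic_subspaces:
  fixes M :: "real^'n^'n"
  assumes sym: "transpose M = M"
    and S: "subspace S" and inv: "\<And>z. z \<in> S \<Longrightarrow> M *v z \<in> S"
    and x: "x \<in> S" and y: "y \<in> orthogonal_comp S"
  shows "orthogonal_subspaces (cyclic_subspace M x) (cyclic_subspace M y)"
proof -
  have self_adjoint: "(M *v a) \<bullet> b = a \<bullet> (M *v b)" for a b
    by (metis dot_lmul_matrix sym transpose_matrix_vector)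
  have "cyclic_subspace M y \<subseteq> orthogonal_comp S"
  proof (rule cyclic_subspace_least)
    show "M *v z \<in> orthogonal_comp S" if "z \<in> orthogonal_comp S" for z
      using that inv by (auto simp: orthogonal_comp_def orthogonal_def simp flip: self_adjoint)
  qed (use y subspace_orthogonal_comp in auto)
  moreover have "cyclic_subspace M x \<subseteq> S"
    by (rule cyclic_subspace_least) (use S inv x in auto)
  ultimately show ?thesis
    by (auto simp: orthogonal_subspaces_def orthogonal_comp_def)
qed

lemma laplacian_component:
  "(laplacian_matrix E *v x) $ u = (\<Sum>w | E u w. x $ u - x $ w)"
proof -
  have "(laplacian_matrix E *v x) $ u
      = (\<Sum>w\<in>UNIV. (if u = w then real (card {w. E u w}) * x $ w else 0)
                    - (if E u w then x $ w else 0))"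
    by (auto simp: laplacian_matrix_def degree_matrix_def adjacency_matrix_def
        matrix_vector_mult_def algebra_simps intro!: sum.cong)
  also have "\<dots> = real (card {w. E u w}) * x $ u - (\<Sum>w | E u w. x $ w)"
    by (simp add: sum_subtractf flip: sum.inter_filter)
  finally show ?thesis
    by (simp add: sum_subtractf)
qed

lemma transpose_laplacian_matrix:
  "symp E \<Longrightarrow> transpose (laplacian_matrix E) = laplacian_matrix E"
  by (auto simp: vec_eq_iff transpose_def laplacian_matrix_def degree_matrix_def
      adjacency_matrix_def dest: sympD)

definition mirrored_invariant :: "('v \<Rightarrow> 'v \<Rightarrow> bool) \<Rightarrow> 'v \<Rightarrow> (real^('v::finite + 'v)) set" where
  "mirrored_invariant E c =
     {x. (\<forall>v. x $ Inr v = x $ Inl v) \<and> (\<forall>f\<in>Aut_fixing E c. \<forall>v. x $ Inl (f v) = x $ Inl v)}"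

lemma subspace_mirrored_invariant: "subspace (mirrored_invariant E c)"
  by (auto simp: subspace_def mirrored_invariant_def)

lemma sum_neighbours_automorphism:
  assumes "f \<in> Aut_fixing E c"
  shows "(\<Sum>w | E (f u) w. g w) = (\<Sum>w | E u w. g (f w))"
proof -
  have f: "bij f" "\<And>u v. E (f u) (f v) \<longleftrightarrow> E u v"
    using assms by (auto simp: Aut_fixing_def)
  have "{w. E (f u) w} = f ` {w. E u w}"
    using f by (auto simp: image_iff) (metis bij_pointE)
  then show ?thesis
    using f(1) by (simp add: sum.reindex bij_is_inj inj_on_subset[OF bij_is_inj])
qed

text \<open>
  An added edge joins copies of two vertices in one orbit, where \<open>x\<close> takes equal values. Its
  contribution to the degree term thus cancels its contribution to the adjacency term, and only
  the edges inside one copy of \<open>G\<close> remain.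
\<close>

lemma laplacian_of_mirrored_invariant:
  fixes E :: "'v::finite \<Rightarrow> 'v \<Rightarrow> bool"
  assumes cons: "L_cospectral_construction E c E'" and sym: "symp E'"
    and x: "x \<in> mirrored_invariant E c"
  shows "(laplacian_matrix E' *v x) $ Inl u = (\<Sum>w | E u w. x $ Inl u - x $ Inl w)"
    and "(laplacian_matrix E' *v x) $ Inr u = (\<Sum>w | E u w. x $ Inl u - x $ Inl w)"
proof -
  have mirrored: "x $ Inr v = x $ Inl v" for v
    using x by (simp add: mirrored_invariant_def)
  have cross: "x $ Inl v = x $ Inl w" if "E' (Inl v) (Inr w)" for v w
    using that cons x
    by (fastforce simp: L_cospectral_construction_def vertex_orbit_def mirrored_invariant_def)
  have split: "(\<Sum>w | P w. g w) = (\<Sum>w | P (Inl w). g (Inl w)) + (\<Sum>w | P (Inr w). g (Inr w))"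
    for P and g :: "'v + 'v \<Rightarrow> real"
  proof -
    have "{w. P w} = Inl ` {w. P (Inl w)} \<union> Inr ` {w. P (Inr w)}"
      by (auto simp: image_iff) (metis sum.exhaust)
    moreover have "Inl ` {w. P (Inl w)} \<inter> Inr ` {w. P (Inr w)} = {}"
      by auto
    ultimately show ?thesis
      by (simp add: sum.union_disjoint sum.reindex inj_on_def)
  qed
  show "(laplacian_matrix E' *v x) $ Inl u = (\<Sum>w | E u w. x $ Inl u - x $ Inl w)"
    using cons cross
    by (simp add: laplacian_component split mirrored L_cospectral_construction_def)
  have "x $ Inl u = x $ Inl w" if "E' (Inr u) (Inl w)" for w
    using cross sympD[OF sym that] by simp
  then show "(laplacian_matrix E' *v x) $ Inr u = (\<Sum>w | E u w. x $ Inl u - x $ Inl w)"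
    using cons
    by (simp add: laplacian_component split mirrored L_cospectral_construction_def)
qed

lemma laplacian_mirrored_invariant:
  assumes "L_cospectral_construction E c E'" and "symp E'"
    and x: "x \<in> mirrored_invariant E c"
  shows "laplacian_matrix E' *v x \<in> mirrored_invariant E c"
proof -
  have "x $ Inl (f v) = x $ Inl v" if "f \<in> Aut_fixing E c" for f v
    using x that by (simp add: mirrored_invariant_def)
  then show ?thesis
    unfolding mirrored_invariant_def
    by (simp add: laplacian_of_mirrored_invariant[OF assms] sum_neighbours_automorphism)
qed

theorem theorem3p8:
  fixes E :: "'v::finite \<Rightarrow> 'v \<Rightarrow> bool"
    and E' :: "'v + 'v \<Rightarrow> 'v + 'v \<Rightarrow> bool"
    and vc :: 'v
  assumes "connected_graph E"
    and "connected_graph E'"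
    and "L_cospectral_construction E vc E'"
  shows "L_cospectral E' (Inl vc) (Inr vc)"
proof -
  have sym: "symp E'"
    using assms(2) by (simp add: connected_graph_def)
  have "f v = vc \<longleftrightarrow> v = vc" if "f \<in> Aut_fixing E vc" for f v
    using that inj_eq[OF bij_is_inj, of f v vc] by (auto simp: Aut_fixing_def)
  then have "axis (Inl vc) 1 + axis (Inr vc) 1 \<in> mirrored_invariant E vc"
    by (simp add: mirrored_invariant_def axis_def)
  moreover have "axis (Inl vc) 1 - axis (Inr vc) 1 \<in> orthogonal_comp (mirrored_invariant E vc)"
    by (simp add: orthogonal_comp_def orthogonal_def mirrored_invariant_def
        inner_diff_right inner_axis)
  ultimately show ?thesis
    unfolding L_cospectral_def
    using orthogonal_cyclic_subspaces[OF transpose_laplacian_matrix[OF sym]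
        subspace_mirrored_invariant laplacian_mirrored_invariant[OF assms(3) sym]]
    by blast
qed

end
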